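(* Let $p$ be a prime, let $A=\{\mathbf a_1,\dots,\mathbf a_N\}\subseteq\mathbb Z^n$, and let $\beta$ be such that $R_\beta\neq\emptyset$. Let $\sigma_{-\beta}^\circ$, $\beta^{(k)}$, $e$ and $w_\Delta$ be as defined in the context. Then $$w(R_\beta)\ \ge\ \frac{p-1}{e}\sum_{k=0}^{e-1}w_\Delta\big(\sigma_{-\beta}^\circ\cap(-\beta^{(k)}+\mathbb Z^n)\big).$$
   Context: $\mathbb N$ = nonnegative integers. For $t\in\mathbb N$ with base-$p$ digits $t_j$ put $w_p(t)=\sum_j t_j$; for $s\in\mathbb N^N$ put $w_p(s)=\sum_{i=1}^N w_p(s_i)$. Let $R$ be the set of all $r=(r_1,\dots,r_N)\in(\mathbb Q\cap\mathbb Z_p)^N$ with $-1\le r_i\le 0$ for all $i$. For $r\in R$ choose a positive integer $a$ with $(1-p^a)r\in\mathbb N^N$ and put $w(r)=w_p((1-p^a)r)/a$ (independent of the choice of $a$). Put $R_\beta=\{r\in R : \sum_{i=1}^N r_i\mathbf a_i=\beta\}$ and $w(R_\beta)=\inf\{w(r) : r\in R_\beta\}$. Cyclic shift: for a nonnegative integer $t=t_0+t_1p+\cdots+t_{a-1}p^{a-1}$ ($0\le t_j\le p-1$, $a$ fixed) put $t'=t_1+t_2p+\cdots+t_{a-1}p^{a-2}+t_0p^{a-1}$, and let $t^{(k)}$ be the $k$-fold iterate; for vectors apply this componentwise. For $r\in R$ with $s=(1-p^a)r\in\mathbb N^N$ put $r^{(k)}=(1-p^a)^{-1}s^{(k)}\in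 R$ (independent of the choice of $a$). Let $\Delta$ be the convex hull of $A\cup\{\mathbf 0\}$ in $\mathbb R^n$ and $C(\Delta)$ the real cone generated by $\Delta$. For $\gamma\in C(\Delta)$ let $w_\Delta(\gamma)$ be the smallest real $w\ge 0$ such that $\gamma\in w\Delta$; equivalently $w_\Delta(\gamma)=\min\{\sum_i t_i : t_i\in\mathbb R_{\ge0},\ \sum_i t_i\mathbf a_i=\gamma\}$. For $X\subseteq C(\Delta)$ put $w_\Delta(X)=\inf\{w_\Delta(\gamma):\gamma\in X\}$. Let $\sigma_{-\beta}$ be the smallest closed face of $C(\Delta)$ containing $-\beta$, and let $\sigma_{-\beta}^\circ$ be $\sigma_{-\beta}$ minus the union of all its proper closed faces. For $r,\tilde r\in R_\beta$ one has $-\sum_i r_i^{(k)}\mathbf a_i\equiv-\sum_i\tilde r_i^{(k)}\mathbf a_i \pmod{\mathbb Z^n}$; choose $\beta^{(k)}\in\mathbb Q^n$ such that $-\sum_{i=1}^N r_i^{(k)}\mathbf a_i\in-\beta^{(k)}+\mathbb Z^n$ for all $r\in R_\beta$. Let $e$ be the smallest positive integer such that $-\beta^{(e)}+\mathbb Z^n=-\beta+\mathbb Z^n$. *)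

theory Defs
  imports "HOL-Analysis.Analysis" "HOL-Computational_Algebra.Primes"
begin

definition digit :: "nat \<Rightarrow> nat \<Rightarrow> nat \<Rightarrow> nat" where
  "digit p t j = t div p ^ j mod p"

text \<open>The summation range contains every index of a nonzero digit and is finite for \<open>p \<ge> 2\<close>.\<close>
definition digit_sum :: "nat \<Rightarrow> nat \<Rightarrow> nat" where
  "digit_sum p t = (\<Sum>j | p ^ j \<le> t. digit p t j)"

definition digit_sum_vec :: "nat \<Rightarrow> nat ^ 'm \<Rightarrow> nat" where
  "digit_sum_vec p s = (\<Sum>i\<in>UNIV. digit_sum p (s $ i))"

definition cyclic_shift :: "nat \<Rightarrow> nat \<Rightarrow> nat \<Rightarrow> nat" where
  "cyclic_shift p a t = (\<Sum>j<a - 1. digit p t (Suc j) * p ^ j) + digit p t 0 * p ^ (a - 1)"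

text \<open>The ring \<open>\<rat> \<inter> \<int>\<^sub>p\<close>, as a set of real numbers.\<close>
definition p_integral_rationals :: "nat \<Rightarrow> real set" where
  "p_integral_rationals p = {of_int u / of_int v | u v :: int. \<not> int p dvd v}"

definition R_set :: "nat \<Rightarrow> (real ^ 'm) set" where
  "R_set p = {r. \<forall>i. r $ i \<in> p_integral_rationals p \<and> -1 \<le> r $ i \<and> r $ i \<le> 0}"

text \<open>
  For \<open>r \<in> R_set p\<close> an exponent as below exists because the denominators of the coordinates
  are prime to \<open>p\<close>; the notions defined from it do not depend on the chosen exponent.
\<close>
definition period :: "nat \<Rightarrow> real ^ 'm \<Rightarrow> nat" where
  "period p r = (SOME a. 0 < a \<and> (\<forall>i. (1 - real p ^ a) * r $ i \<in> \<nat>))"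

text \<open>For \<open>r \<in> R_set p\<close> the floor is taken of a natural number.\<close>
definition s_vec :: "nat \<Rightarrow> real ^ 'm \<Rightarrow> nat ^ 'm" where
  "s_vec p r = (\<chi> i. nat \<lfloor>(1 - real p ^ period p r) * r $ i\<rfloor>)"

definition weight :: "nat \<Rightarrow> real ^ 'm \<Rightarrow> real" where
  "weight p r = real (digit_sum_vec p (s_vec p r)) / real (period p r)"

definition r_shift :: "nat \<Rightarrow> nat \<Rightarrow> real ^ 'm \<Rightarrow> real ^ 'm" where
  "r_shift p k r =
     (\<chi> i. real ((cyclic_shift p (period p r) ^^ k) (s_vec p r $ i)) / (1 - real p ^ period p r))"

definition R_beta :: "nat \<Rightarrow> ('m::finite \<Rightarrow> real ^ 'n) \<Rightarrow> real ^ 'n \<Rightarrow> (real ^ 'm) set" where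
  "R_beta p a \<beta> = {r \<in> R_set p. (\<Sum>i\<in>UNIV. r $ i *\<^sub>R a i) = \<beta>}"

text \<open>\<open>R_beta p a \<beta>\<close> is assumed nonempty where this is used, and weights are nonnegative,
  so the real-valued infimum is the usual one.\<close>
definition weight_R_beta :: "nat \<Rightarrow> ('m::finite \<Rightarrow> real ^ 'n) \<Rightarrow> real ^ 'n \<Rightarrow> real" where
  "weight_R_beta p a \<beta> = (INF r\<in>R_beta p a \<beta>. weight p r)"

definition int_lattice :: "(real ^ 'n) set" where
  "int_lattice = {v. \<forall>j. v $ j \<in> \<int>}"

definition lattice_coset :: "real ^ 'n \<Rightarrow> (real ^ 'n) set" where
  "lattice_coset v = (\<lambda>z. v + z) ` int_lattice"

definition Delta :: "('m \<Rightarrow> real ^ 'n) \<Rightarrow> (real ^ 'n) set" where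
  "Delta a = convex hull (range a \<union> {0})"

definition cone_Delta :: "('m \<Rightarrow> real ^ 'n) \<Rightarrow> (real ^ 'n) set" where
  "cone_Delta a = convex_cone hull (Delta a)"

text \<open>Meaningful for \<open>\<gamma> \<in> cone_Delta a\<close>, where the minimum exists because \<open>Delta a\<close> is compact
  and contains the origin.\<close>
definition w_Delta :: "('m \<Rightarrow> real ^ 'n) \<Rightarrow> real ^ 'n \<Rightarrow> real" where
  "w_Delta a \<gamma> = (LEAST w. 0 \<le> w \<and> \<gamma> \<in> (\<lambda>x. w *\<^sub>R x) ` Delta a)"

text \<open>Applied only to nonempty subsets of \<open>cone_Delta a\<close>.\<close>
definition w_Delta_set :: "('m \<Rightarrow> real ^ 'n) \<Rightarrow> (real ^ 'n) set \<Rightarrow> real" where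
  "w_Delta_set a X = (INF \<gamma>\<in>X. w_Delta a \<gamma>)"

text \<open>An intersection of closed faces is a closed face, so for \<open>\<gamma> \<in> cone_Delta a\<close> this is the
  smallest one containing \<open>\<gamma>\<close>.\<close>
definition min_face :: "('m \<Rightarrow> real ^ 'n) \<Rightarrow> real ^ 'n \<Rightarrow> (real ^ 'n) set" where
  "min_face a \<gamma> = \<Inter>{F. F face_of cone_Delta a \<and> closed F \<and> \<gamma> \<in> F}"

definition open_face :: "('m \<Rightarrow> real ^ 'n) \<Rightarrow> real ^ 'n \<Rightarrow> (real ^ 'n) set" where
  "open_face a \<gamma> =
     min_face a \<gamma> - \<Union>{F. F face_of min_face a \<gamma> \<and> closed F \<and> F \<noteq> min_face a \<gamma>}"

text \<open>
  \<open>b k\<close> is an admissible choice of \<open>\<beta>\<^sup>(\<^sup>k\<^sup>)\<close> for every \<open>k\<close>. Only the cosets of the \<open>b k\<close> modulo the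
  integer lattice matter, and these are determined by the condition when \<open>R_beta p a \<beta>\<close> is nonempty.
\<close>
definition is_beta_shift ::
    "nat \<Rightarrow> ('m::finite \<Rightarrow> real ^ 'n) \<Rightarrow> real ^ 'n \<Rightarrow> (nat \<Rightarrow> real ^ 'n) \<Rightarrow> bool" where
  "is_beta_shift p a \<beta> b \<longleftrightarrow>
     (\<forall>k. (\<forall>j. b k $ j \<in> \<rat>) \<and>
          (\<forall>r\<in>R_beta p a \<beta>. - (\<Sum>i\<in>UNIV. r_shift p k r $ i *\<^sub>R a i) \<in> lattice_coset (- b k)))"

definition beta_period :: "real ^ 'n \<Rightarrow> (nat \<Rightarrow> real ^ 'n) \<Rightarrow> nat" where
  "beta_period \<beta> b = (LEAST e. 0 < e \<and> lattice_coset (- b e) = lattice_coset (- \<beta>))"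

text \<open>
  The remaining facts show that the choices above can be made: \<open>period\<close> picks an existing exponent,
  and an admissible family of vectors in the sense of \<open>is_beta_shift\<close> exists whenever
  \<open>R_beta p a \<beta>\<close> is nonempty.
\<close>

lemma digits_sum: "p > 0 \<Longrightarrow> t < p ^ a \<Longrightarrow> (\<Sum>j<a. digit p t j * p ^ j) = t"
proof (induction a arbitrary: t)
  case 0 then show ?case by simp
next
  case (Suc a)
  have lt: "t div p < p ^ a" using Suc.prems by (simp add: less_mult_imp_div_less mult.commute)
  have d: "digit p t (Suc j) = digit p (t div p) j" for j
    by (simp add: digit_def div_mult2_eq)
  have "(\<Sum>j<Suc a. digit p t j * p ^ j) = digit p t 0 + (\<Sum>j<a. digit p (t div p) j * p ^ Suc j)"
    by (subst sum.lessThan_Suc_shift) (simp add: d)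
  also have "(\<Sum>j<a. digit p (t div p) j * p ^ Suc j) = p * (\<Sum>j<a. digit p (t div p) j * p ^ j)"
    by (simp add: sum_distrib_left mult_ac)
  also have "\<dots> = p * (t div p)" using Suc.IH[OF Suc.prems(1) lt] by simp
  finally show ?case by (simp add: digit_def)
qed

lemma shift_eq: assumes "p > 0" "a > 0" "t < p ^ a"
  shows "p * cyclic_shift p a t + digit p t 0 = t + digit p t 0 * p ^ a"
proof -
  obtain a' where a: "a = Suc a'" using assms by (cases a) auto
  have "(\<Sum>j<Suc a'. digit p t j * p ^ j) = t" using digits_sum[of p t a] assms a by simp
  hence "digit p t 0 + (\<Sum>j<a'. digit p t (Suc j) * p ^ Suc j) = t"
    by (subst (asm) sum.lessThan_Suc_shift) simp
  moreover have "p * cyclic_shift p a t = (\<Sum>j<a'. digit p t (Suc j) * p ^ Suc j) + digit p t 0 * p ^ a"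
    by (simp add: cyclic_shift_def a sum_distrib_left mult_ac distrib_left)
  ultimately show ?thesis by simp
qed

lemma shift_lt: assumes "p > 0" "a > 0" "t < p ^ a"
  shows "cyclic_shift p a t < p ^ a"
proof -
  have d: "digit p t 0 \<le> p - 1" using assms by (simp add: digit_def) (metis Suc_pred less_Suc_eq_le mod_less_divisor)
  have "p * cyclic_shift p a t + digit p t 0 < p ^ a + digit p t 0 * p ^ a"
    using shift_eq[OF assms] assms by simp
  also have "\<dots> \<le> p ^ a + (p - 1) * p ^ a" using d by (simp add: mult_right_mono)
  also have "\<dots> = p * p ^ a" using assms by (cases p) auto
  finally have "p * cyclic_shift p a t < p * p ^ a" by linarith
  thus ?thesis using assms by simp
qed

lemma period_ex: assumes p: "prime p" and r: "r \<in> R_set p"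
  shows "\<exists>a. 0 < a \<and> (\<forall>i. (1 - real p ^ a) * r $ i \<in> \<nat>)"
proof -
  have "\<exists>v u::int. \<not> int p dvd v \<and> r $ i = of_int u / of_int v" for i
    using r unfolding R_set_def p_integral_rationals_def mem_Collect_eq by metis
  then obtain v u where vu: "\<And>i. \<not> int p dvd v i" "\<And>i. r $ i = of_int (u i) / of_int (v i :: int)"
    by metis
  define V where "V = (\<Prod>i\<in>UNIV. v i)"
  have cop: "coprime (int p) V" unfolding V_def
    using vu(1) p by (intro prod_coprime_right) (auto intro: prime_imp_coprime)
  have V0: "V \<noteq> 0" using vu(1) unfolding V_def by (metis dvd_0_right finite prod_zero_iff)
  have "\<exists>i<nat \<bar>V\<bar> + 1. \<exists>j<nat \<bar>V\<bar> + 1. i < j \<and> int p ^ i mod V = int p ^ j mod V"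
  proof (rule ccontr)
    assume c: "\<not> ?thesis"
    have inj: "inj_on (\<lambda>i. int p ^ i mod \<bar>V\<bar>) {..<nat \<bar>V\<bar> + 1}"
    proof (rule linorder_inj_onI', goal_cases)
      case (1 i j)
      { assume "int p ^ i mod \<bar>V\<bar> = int p ^ j mod \<bar>V\<bar>"
        hence "int p ^ i mod V = int p ^ j mod V" by (simp add: mod_eq_dvd_iff)
        hence False using c 1 by auto }
      thus ?case by blast
    qed
    have "(\<lambda>i. int p ^ i mod \<bar>V\<bar>) ` {..<nat \<bar>V\<bar> + 1} \<subseteq> {0..<\<bar>V\<bar>}" using V0 by auto
    from card_mono[OF _ this] have "card ((\<lambda>i. int p ^ i mod \<bar>V\<bar>) ` {..<nat \<bar>V\<bar> + 1}) \<le> nat \<bar>V\<bar>" by simp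
    thus False using card_image[OF inj] by simp
  qed
  then obtain i j where ij: "i < j" "int p ^ i mod V = int p ^ j mod V" by blast
  define a where "a = j - i"
  have a: "a > 0" "j = i + a" using ij by (auto simp: a_def)
  have "V dvd int p ^ i * (1 - int p ^ a)" using ij(2) a by (simp add: mod_eq_dvd_iff algebra_simps power_add)
  moreover have "coprime V (int p ^ i)" using cop by (simp add: coprime_commute)
  ultimately have dv: "V dvd 1 - int p ^ a" by (simp add: coprime_dvd_mult_right_iff)
  have "(1 - real p ^ a) * r $ k \<in> \<nat>" for k
  proof -
    have "v k dvd V" unfolding V_def by (rule dvd_prodI) auto
    then obtain m where m: "1 - int p ^ a = v k * m" using dv by (metis dvd_trans dvdE)
    have "real_of_int (1 - int p ^ a) = of_int (v k) * of_int m" unfolding m by simp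
    moreover have "v k \<noteq> 0" using vu(1)[of k] by auto
    ultimately have e: "(1 - real p ^ a) * r $ k = of_int (m * u k)" by (simp add: vu(2)[of k])
    have "1 - real p ^ a \<le> 0" using prime_ge_1_nat[OF p] by simp
    hence "(1 - real p ^ a) * r $ k \<ge> 0" using r unfolding R_set_def by (auto simp: mult_nonpos_nonpos)
    thus ?thesis using e by (metis Nats_altdef2 Ints_of_int mem_Collect_eq Nats_altdef1 of_int_0_le_iff)
  qed
  thus ?thesis using a by blast
qed

lemma shift_props: assumes p: "prime p" and r: "r \<in> R_set p"
  shows "\<exists>D::int. \<not> int p dvd D \<and> (\<forall>k i. of_int D * r_shift p k r $ i \<in> \<int>)"
    and "real p ^ k * r_shift p k r $ i - r $ i \<in> \<int>"
proof -
  define a where "a = period p r"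
  have a: "a > 0" "\<And>i. (1 - real p ^ a) * r $ i \<in> \<nat>"
    using someI_ex[OF period_ex[OF p r]] unfolding a_def period_def by auto
  have p1: "p > 1" using p prime_gt_1_nat by blast
  have pa: "real p ^ a > 1" using a p1 by simp
  have s: "real (s_vec p r $ i) = (1 - real p ^ a) * r $ i" for i
    using a(2)[of i] by (auto simp: s_vec_def a_def Nats_def)
  have slt: "s_vec p r $ i < p ^ a" for i
  proof -
    have "(real p ^ a - 1) * (- r $ i) \<le> (real p ^ a - 1) * 1"
      using r pa unfolding R_set_def by (intro mult_left_mono) (auto simp: minus_le_iff)
    hence "real (s_vec p r $ i) \<le> real p ^ a - 1" using s[of i] by (simp add: algebra_simps)
    hence "real (s_vec p r $ i) < real (p ^ a)" by (simp only: of_nat_power)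
    thus ?thesis by (simp only: of_nat_less_iff)
  qed
  have rs: "r_shift p k r $ i = real ((cyclic_shift p a ^^ k) (s_vec p r $ i)) / (1 - real p ^ a)" for k i
    by (simp add: r_shift_def a_def)
  have it: "(cyclic_shift p a ^^ k) (s_vec p r $ i) < p ^ a" for k i
    by (induction k) (use slt shift_lt a p1 in auto)
  show "\<exists>D::int. \<not> int p dvd D \<and> (\<forall>k i. of_int D * r_shift p k r $ i \<in> \<int>)"
  proof (intro exI conjI allI)
    show "\<not> int p dvd 1 - int p ^ a"
    proof
      assume "int p dvd 1 - int p ^ a"
      moreover have "int p dvd int p ^ a" using a by simp
      ultimately have "int p dvd 1" by (metis dvd_add diff_add_cancel)
      thus False using p1 by simp
    qed
    fix k i
    show "of_int (1 - int p ^ a) * r_shift p k r $ i \<in> \<int>" using pa by (simp add: rs)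
  qed
  show "real p ^ k * r_shift p k r $ i - r $ i \<in> \<int>"
  proof (induction k)
    case 0
    show ?case using pa s[of i] by (simp add: rs)
  next
    case (Suc k)
    define t where "t = (cyclic_shift p a ^^ k) (s_vec p r $ i)"
    have "real (p * cyclic_shift p a t + digit p t 0) = real (t + digit p t 0 * p ^ a)"
      using shift_eq[of p a t] it[of k i] a p1 unfolding t_def by simp
    hence "real p * (real (cyclic_shift p a t) / (1 - real p ^ a)) = real t / (1 - real p ^ a) - real (digit p t 0)"
      using pa by (simp add: field_simps)
    hence "real p * r_shift p (Suc k) r $ i = r_shift p k r $ i - real (digit p t 0)"
      by (simp add: rs t_def)
    hence "real p ^ k * (real p * r_shift p (Suc k) r $ i) = real p ^ k * (r_shift p k r $ i - real (digit p t 0))"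
      by simp
    hence "real p ^ Suc k * r_shift p (Suc k) r $ i - r $ i = (real p ^ k * r_shift p k r $ i - r $ i) - real p ^ k * real (digit p t 0)"
      by (simp add: algebra_simps)
    also have "\<dots> \<in> \<int>" by (rule Ints_diff[OF Suc]) auto
    finally show ?case .
  qed
qed

lemma coprime_Ints: assumes "coprime m (n::int)" "of_int m * x \<in> \<int>" "of_int n * x \<in> \<int>"
  shows "(x::real) \<in> \<int>"
proof -
  obtain u v where "u * m + v * n = 1" using assms(1) by (metis bezout_int coprime_iff_gcd_eq_1)
  hence "real_of_int (u * m + v * n) = 1" by simp
  hence "x = of_int u * (of_int m * x) + of_int v * (of_int n * x)" 
    by (simp add: distrib_right [symmetric] mult.assoc [symmetric])
  thus ?thesis using assms by (metis Ints_add Ints_mult Ints_of_int)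
qed

lemma is_beta_shift_exists:
  assumes p: "prime p" and A: "range a \<subseteq> int_lattice" and ne: "R_beta p a \<beta> \<noteq> {}"
  shows "\<exists>b. is_beta_shift p a \<beta> b"
proof -
  obtain q where q: "q \<in> R_beta p a \<beta>" using ne by blast
  define b where "b k = (\<Sum>i\<in>UNIV. r_shift p k q $ i *\<^sub>R a i)" for k
  have aI: "a i $ j \<in> \<int>" for i j using A by (auto simp: int_lattice_def)
  have "is_beta_shift p a \<beta> b" unfolding is_beta_shift_def
  proof (intro allI conjI ballI)
    fix k j
    show "b k $ j \<in> \<rat>" unfolding b_def
      using aI Ints_subset_Rats by (auto intro!: Rats_sum Rats_mult Rats_divide simp: r_shift_def)
  next
    fix k r assume r: "r \<in> R_beta p a \<beta>"
    define d where "d i = r_shift p k r $ i - r_shift p k q $ i" for i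
    define x where "x = (\<Sum>i\<in>UNIV. d i *\<^sub>R a i)"
    have rR: "r \<in> R_set p" "q \<in> R_set p" and rb: "(\<Sum>i\<in>UNIV. (r $ i - q $ i) *\<^sub>R a i) = 0"
      using r q by (auto simp: R_beta_def scaleR_diff_left sum_subtractf)
    have "x $ j \<in> \<int>" for j
    proof -
      obtain D E :: int where D: "\<not> int p dvd D" "\<And>i. of_int D * r_shift p k r $ i \<in> \<int>"
        and E: "\<not> int p dvd E" "\<And>i. of_int E * r_shift p k q $ i \<in> \<int>"
        using shift_props(1)[OF p rR(1)] shift_props(1)[OF p rR(2)] by blast
      have "of_int (D * E) * d i \<in> \<int>" for i
      proof -
        have "of_int (D * E) * d i = of_int E * (of_int D * r_shift p k r $ i) - of_int D * (of_int E * r_shift p k q $ i)"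
          by (simp add: d_def algebra_simps)
        thus ?thesis using D(2) E(2) by (metis Ints_diff Ints_mult Ints_of_int)
      qed
      hence 1: "of_int (D * E) * x $ j \<in> \<int>"
        using aI unfolding x_def sum_component vector_scaleR_component real_scaleR_def sum_distrib_left mult.assoc[symmetric]
        by (intro Ints_sum) (metis \<open>\<And>i. of_int (D * E) * d i \<in> \<int>\<close> Ints_mult)
      have "real p ^ k * d i - (r $ i - q $ i) \<in> \<int>" for i
      proof -
        have "real p ^ k * d i - (r $ i - q $ i) = (real p ^ k * r_shift p k r $ i - r $ i) - (real p ^ k * r_shift p k q $ i - q $ i)"
          by (simp add: d_def algebra_simps)
        thus ?thesis using shift_props(2)[OF p] rR by (metis Ints_diff)
      qed
      hence "(\<Sum>i\<in>UNIV. (real p ^ k * d i - (r $ i - q $ i)) * a i $ j) \<in> \<int>" using aI by auto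
      also have "(\<Sum>i\<in>UNIV. (real p ^ k * d i - (r $ i - q $ i)) * a i $ j) =
         real p ^ k * x $ j - (\<Sum>i\<in>UNIV. (r $ i - q $ i) *\<^sub>R a i) $ j"
        by (simp add: x_def left_diff_distrib sum_subtractf sum_distrib_left mult.assoc)
      finally have 2: "of_int (int p ^ k) * x $ j \<in> \<int>" using rb by simp
      have "coprime (int p ^ k) (D * E)" using D E p
        by (auto simp: coprime_power_left_iff intro!: coprime_mult_right_iff[THEN iffD2] prime_imp_coprime)
      from coprime_Ints[OF this 2 1] show ?thesis .
    qed
    hence "- x \<in> int_lattice" by (auto simp: int_lattice_def)
    moreover have "- (\<Sum>i\<in>UNIV. r_shift p k r $ i *\<^sub>R a i) = - b k + - x"
      by (simp add: b_def x_def d_def scaleR_diff_left sum_subtractf)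
    ultimately show "- (\<Sum>i\<in>UNIV. r_shift p k r $ i *\<^sub>R a i) \<in> lattice_coset (- b k)"
      unfolding lattice_coset_def by (metis image_eqI)
  qed
  thus ?thesis by blast
qed

end

theory Submission
  imports Defs
begin

text \<open>
  Summing \<open>s_vec p r\<close> over a full cycle of shifts counts each digit at every position, so \<open>weight p r\<close>
  is \<open>p - 1\<close> times the average over \<open>k\<close> of the coefficient sum of \<open>\<gamma> k = - (\<Sum>i. r_shift p k r $ i *\<^sub>R a i)\<close>.
  That coefficient sum is at least \<open>w_Delta a (\<gamma> k)\<close>. Shifting does not change which coordinates vanish,
  so \<open>\<gamma> k\<close> lies in the same open face as \<open>\<gamma> 0 = - \<beta>\<close>. Finally \<open>k \<mapsto> \<gamma> k\<close> modulo the integer lattice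
  has period \<open>e\<close>, and the two averages are compared over a common multiple of both periods.
\<close>

subsection \<open>Cyclic shifts of digits\<close>

text \<open>Subtracting \<open>t mod p\<close> in \<open>shift_eq\<close> and cancelling
  \<open>p\<close> leaves the higher digits one place lower and the low digit on top.\<close>

lemma cyclic_shift_eq_div_mod:
  assumes "p > 0" "n > 0" "t < p ^ n"
  shows "cyclic_shift p n t = t div p + (t mod p) * p ^ (n - 1)"
proof -
  have "p * cyclic_shift p n t + t mod p = t + (t mod p) * p ^ n"
    using shift_eq[OF assms] by (simp add: digit_def)
  also have "p ^ n = p * p ^ (n - 1)" using assms(2) by (cases n) auto
  also have "t + (t mod p) * (p * p ^ (n - 1)) = p * (t div p + (t mod p) * p ^ (n - 1)) + t mod p"
    by (simp add: algebra_simps)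
  finally show ?thesis using assms(1) by simp
qed

lemma funpow_cyclic_shift_lt:
  assumes "p > 0" "n > 0" "t < p ^ n"
  shows "(cyclic_shift p n ^^ k) t < p ^ n"
  by (induction k) (use assms shift_lt in auto)

text \<open>Rotating \<open>k\<close> times exchanges two blocks of digits: the top
  \<open>n - k\<close> move down and the low \<open>k\<close> move above them. Each induction step
  transfers one more digit; \<open>k <= n\<close> keeps \<open>n - k\<close> from being
  truncated.\<close>

lemma funpow_cyclic_shift_eq_div_mod:
  assumes "p > 0" "n > 0" "t < p ^ n" "k \<le> n"
  shows "(cyclic_shift p n ^^ k) t = t div p ^ k + (t mod p ^ k) * p ^ (n - k)"
  using assms(4)
proof (induction k)
  case 0
  then show ?case by simp
next
  case (Suc k)
  define m where "m = n - Suc k"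
  have m: "n - k = Suc m" "n - 1 = k + m" using Suc.prems by (auto simp: m_def)
  define u where "u = (cyclic_shift p n ^^ k) t"
  \<comment> \<open>The summand carrying the low block is a multiple of \<open>p\<close>, so the
    lowest digit of \<open>u\<close> is digit \<open>k\<close> of \<open>t\<close>.\<close>
  have u: "u = t div p ^ k + p * ((t mod p ^ k) * p ^ m)"
    using Suc by (simp add: u_def m mult_ac)
  have um: "u mod p = t div p ^ k mod p" by (simp add: u)
  have ud: "u div p = t div p ^ Suc k + (t mod p ^ k) * p ^ m"
    using assms(1) by (simp add: u div_mult2_eq[symmetric] mult.commute)
  have "(cyclic_shift p n ^^ Suc k) t = cyclic_shift p n u" by (simp add: u_def)
  also have "\<dots> = u div p + (u mod p) * p ^ (n - 1)"
    using cyclic_shift_eq_div_mod assms funpow_cyclic_shift_lt unfolding u_def by blast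
  also have "\<dots> = t div p ^ Suc k + (p ^ k * (t div p ^ k mod p) + t mod p ^ k) * p ^ m"
    unfolding um ud m(2) by (simp add: algebra_simps power_add)
  also have "p ^ k * (t div p ^ k mod p) + t mod p ^ k = t mod p ^ Suc k"
    by (simp add: mod_mult2_eq mult.commute[of p])
  finally show ?case by (simp add: m_def)
qed

lemma funpow_cyclic_shift_period:
  assumes "p > 0" "n > 0" "t < p ^ n"
  shows "(cyclic_shift p n ^^ (k + n)) t = (cyclic_shift p n ^^ k) t"
proof -
  have "(cyclic_shift p n ^^ n) t = t"
    using funpow_cyclic_shift_eq_div_mod[OF assms order_refl] assms by simp
  then show ?thesis by (simp add: funpow_add)
qed

text \<open>For \<open>k < n\<close> the low block lands at the positive position
  \<open>n - k\<close> and cannot disturb position 0.\<close>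

lemma digit_funpow_cyclic_shift:
  assumes "p > 0" "n > 0" "t < p ^ n" "k < n"
  shows "digit p ((cyclic_shift p n ^^ k) t) 0 = digit p t k"
proof -
  have "p ^ (n - k) = p * p ^ (n - k - 1)" using assms(4) by (metis Suc_diff_1 power_Suc zero_less_diff)
  then have "(cyclic_shift p n ^^ k) t = t div p ^ k + p * ((t mod p ^ k) * p ^ (n - k - 1))"
    using funpow_cyclic_shift_eq_div_mod[OF assms(1-3), of k] assms(4) by (simp add: mult_ac)
  then show ?thesis by (simp add: digit_def)
qed

text \<open>Rotation permutes the digits, so it neither creates nor destroys a nonzero one.\<close>

lemma funpow_cyclic_shift_eq_0_iff:
  assumes "p > 1" "n > 0" "t < p ^ n"
  shows "(cyclic_shift p n ^^ k) t = 0 \<longleftrightarrow> t = 0"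
proof (induction k)
  case (Suc k)
  define u where "u = (cyclic_shift p n ^^ k) t"
  have "u < p ^ n" using funpow_cyclic_shift_lt assms unfolding u_def by simp
  then have "cyclic_shift p n u = u div p + (u mod p) * p ^ (n - 1)"
    using cyclic_shift_eq_div_mod assms by simp
  then have "cyclic_shift p n u = 0 \<longleftrightarrow> u div p = 0 \<and> u mod p = 0" using assms by auto
  also have "\<dots> \<longleftrightarrow> u = 0" by (metis div_0 mod_0 div_mult_mod_eq mult_zero_left add_0)
  finally show ?case using Suc by (simp add: u_def)
qed simp

text \<open>The extra positions satisfy \<open>p ^ j > t\<close> and hold the digit 0. The new range
  is the same for all coordinates of a vector.\<close>

lemma digit_sum_eq_sum_lessThan:
  assumes "p > 1" "t < p ^ n"
  shows "digit_sum p t = (\<Sum>j<n. digit p t j)"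
proof -
  have "{j. p ^ j \<le> t} \<subseteq> {..<n}"
    using assms by (auto dest: le_less_trans simp: power_strict_increasing_iff)
  then show ?thesis unfolding digit_sum_def
    by (intro sum.mono_neutral_left) (auto simp: digit_def)
qed

text \<open>Each digit of \<open>t\<close> visits every position exactly once along a full cycle.\<close>
lemma sum_funpow_cyclic_shift:
  assumes "p > 1" "n > 0" "t < p ^ n"
  shows "(real p - 1) * (\<Sum>k<n. real ((cyclic_shift p n ^^ k) t)) = (real p ^ n - 1) * real (digit_sum p t)"
proof -
  let ?s = "\<lambda>k. (cyclic_shift p n ^^ k) t"
  \<comment> \<open>This is \<open>shift_eq\<close> for the \<open>k\<close>-th rotate, whose lowest
    digit is digit \<open>k\<close> of \<open>t\<close>. Summed over \<open>k\<close>, the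
    right-hand sides give the digit sum.\<close>
  have step: "real p * real (?s (Suc k)) - real (?s k) = (real p ^ n - 1) * real (digit p t k)"
    if "k < n" for k
  proof -
    have "p * ?s (Suc k) + digit p t k = ?s k + digit p t k * p ^ n"
      using shift_eq[of p n "?s k"] funpow_cyclic_shift_lt[of p n t k]
        digit_funpow_cyclic_shift[of p n t k] assms that by simp
    then have "real (p * ?s (Suc k) + digit p t k) = real (?s k + digit p t k * p ^ n)" by simp
    then show ?thesis by (simp add: algebra_simps)
  qed
  \<comment> \<open>Moving the summation window by one exchanges the rotates with indices 0 and
    \<open>n\<close>, which are equal.\<close>
  have "(\<Sum>k<n. real (?s (Suc k))) = (\<Sum>k<Suc n. real (?s k)) - real (?s 0)"
    by (subst sum.lessThan_Suc_shift) simp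
  also have "\<dots> = (\<Sum>k<n. real (?s k))"
    using funpow_cyclic_shift_period[of p n t 0] assms by simp
  finally have cyc: "(\<Sum>k<n. real (?s (Suc k))) = (\<Sum>k<n. real (?s k))" .
  have "(real p - 1) * (\<Sum>k<n. real (?s k)) = real p * (\<Sum>k<n. real (?s (Suc k))) - (\<Sum>k<n. real (?s k))"
    unfolding cyc by (simp add: left_diff_distrib)
  also have "\<dots> = (\<Sum>k<n. real p * real (?s (Suc k)) - real (?s k))"
    by (simp only: sum_subtractf sum_distrib_left)
  also have "\<dots> = (\<Sum>k<n. (real p ^ n - 1) * real (digit p t k))"
    using step by (intro sum.cong) auto
  finally show ?thesis using digit_sum_eq_sum_lessThan[OF assms(1,3)]
    by (simp add: sum_distrib_left)
qed

subsection \<open>Shifts of rational vectors\<close>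

context
  fixes p :: nat and r :: "real ^ 'm"
  assumes p: "prime p" and r: "r \<in> R_set p"
begin

text \<open>The bound \<open>-1 \<le> r $ i\<close> yields \<open>s_vec_lt\<close>: the numerators
  fit into \<open>period p r\<close> digits, as the rotation lemmas require.\<close>

lemma period_props:
  shows period_pos: "0 < period p r"
    and power_period_gt_1: "1 < real p ^ period p r"
    and s_vec_eq: "real (s_vec p r $ i) = (1 - real p ^ period p r) * r $ i"
    and s_vec_lt: "s_vec p r $ i < p ^ period p r"
proof -
  have "0 < period p r \<and> (\<forall>i. (1 - real p ^ period p r) * r $ i \<in> \<nat>)"
    unfolding period_def by (rule someI_ex[OF period_ex[OF p r]])
  then have per: "0 < period p r" "\<And>i. (1 - real p ^ period p r) * r $ i \<in> \<nat>" by auto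
  show "0 < period p r" by fact
  show gt: "1 < real p ^ period p r" using per(1) prime_gt_1_nat[OF p] by simp
  show s: "real (s_vec p r $ i) = (1 - real p ^ period p r) * r $ i" for i
    using per(2)[of i] by (auto simp: s_vec_def Nats_def)
  have "(real p ^ period p r - 1) * (- r $ i) \<le> (real p ^ period p r - 1) * 1"
    using r gt unfolding R_set_def by (intro mult_left_mono) (auto simp: minus_le_iff)
  then have "real (s_vec p r $ i) \<le> real p ^ period p r - 1"
    using s[of i] by (simp add: algebra_simps)
  then have "real (s_vec p r $ i) < real (p ^ period p r)" by (simp only: of_nat_power)
  then show "s_vec p r $ i < p ^ period p r" by (simp only: of_nat_less_iff)
qed

lemma r_shift_0: "r_shift p 0 r = r"
  using power_period_gt_1 s_vec_eq by (simp add: r_shift_def vec_eq_iff)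

lemma r_shift_period: "r_shift p (k + period p r) r = r_shift p k r"
  using funpow_cyclic_shift_period[of p "period p r"] prime_gt_0_nat[OF p] period_pos s_vec_lt
  by (simp add: r_shift_def vec_eq_iff)

lemma r_shift_nonpos: "r_shift p k r $ i \<le> 0"
  using power_period_gt_1 by (simp add: r_shift_def divide_nonneg_neg)

text \<open>The support of the coefficient vector is constant along the shifts; this later keeps all
  the combinations in one open face.\<close>

lemma r_shift_eq_0_iff: "r_shift p k r $ i = 0 \<longleftrightarrow> r $ i = 0"
proof -
  have ne: "1 - real p ^ period p r \<noteq> 0" using power_period_gt_1 by linarith
  have "r_shift p k r $ i = 0 \<longleftrightarrow> (cyclic_shift p (period p r) ^^ k) (s_vec p r $ i) = 0"
    unfolding r_shift_def using ne by (simp del: right_minus_eq)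
  also have "\<dots> \<longleftrightarrow> s_vec p r $ i = 0"
    by (rule funpow_cyclic_shift_eq_0_iff[OF prime_gt_1_nat[OF p] period_pos s_vec_lt])
  also have "\<dots> \<longleftrightarrow> (1 - real p ^ period p r) * r $ i = 0"
    using s_vec_eq[of i] by (metis of_nat_eq_0_iff)
  finally show ?thesis using ne by (simp del: right_minus_eq)
qed

text \<open>The factor \<open>p ^ n - 1\<close> of \<open>sum_funpow_cyclic_shift\<close> is minus
  the denominator in \<open>r_shift\<close>, so each digit sum becomes \<open>p - 1\<close> times a
  sum of negated shifted coordinates.\<close>

lemma weight_eq_sum_r_shift:
  "weight p r = (real p - 1) / real (period p r) * (\<Sum>k<period p r. \<Sum>i\<in>UNIV. - r_shift p k r $ i)"
proof -
  define n where "n = period p r"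
  let ?s = "\<lambda>i k. real ((cyclic_shift p n ^^ k) (s_vec p r $ i))"
  have n: "0 < n" "1 < real p ^ n" "\<And>i. s_vec p r $ i < p ^ n"
    using period_pos power_period_gt_1 s_vec_lt by (auto simp: n_def)
  have digs: "real (digit_sum p (s_vec p r $ i)) = (real p - 1) * (\<Sum>k<n. ?s i k) / (real p ^ n - 1)" for i
    using sum_funpow_cyclic_shift[OF prime_gt_1_nat[OF p] n(1) n(3)[of i]] n(2) by simp
  have shift: "- r_shift p k r $ i = ?s i k / (real p ^ n - 1)" for k i
    by (simp add: r_shift_def n_def[symmetric] minus_divide_right)
  have "real (digit_sum_vec p (s_vec p r)) = (\<Sum>i\<in>UNIV. (real p - 1) * (\<Sum>k<n. - r_shift p k r $ i))"
    unfolding digit_sum_vec_def of_nat_sum digs shift by (simp add: sum_divide_distrib[symmetric])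
  also have "\<dots> = (real p - 1) * (\<Sum>k<n. \<Sum>i\<in>UNIV. - r_shift p k r $ i)"
    unfolding sum_distrib_left[symmetric] by (subst sum.swap) simp
  finally show ?thesis by (simp add: weight_def n_def)
qed

end

subsection \<open>The weight function and faces of the cone\<close>

lemma Delta_0: "0 \<in> Delta a"
  unfolding Delta_def by (simp add: hull_inc)

text \<open>Dividing by the total of the coefficients gives a convex combination of the generators.
  If the total is 0, all coefficients vanish and the origin serves as the point of
  \<open>Delta a\<close>.\<close>

lemma convex_combination_in_Delta:
  fixes a :: "'m::finite \<Rightarrow> real ^ 'n"
  assumes "\<And>i. 0 \<le> t i"
  shows "(\<Sum>i\<in>UNIV. t i *\<^sub>R a i) \<in> (\<lambda>x. (\<Sum>i\<in>UNIV. t i) *\<^sub>R x) ` Delta a"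
proof (cases "(\<Sum>i\<in>UNIV. t i) = 0")
  case True
  then have "t i = 0" for i using assms by (simp add: sum_nonneg_eq_0_iff)
  then show ?thesis using Delta_0 by (auto intro: image_eqI[of _ _ 0])
next
  case False
  define T where "T = (\<Sum>i\<in>UNIV. t i)"
  have T: "T \<noteq> 0" "T \<ge> 0" using False assms by (auto simp: T_def sum_nonneg)
  have "(\<Sum>i\<in>UNIV. (t i / T) *\<^sub>R a i) \<in> Delta a"
    unfolding Delta_def
    by (rule convex_sum) (use T assms in \<open>auto simp: hull_inc sum_divide_distrib[symmetric] T_def[symmetric]\<close>)
  moreover have "(\<Sum>i\<in>UNIV. t i *\<^sub>R a i) = T *\<^sub>R (\<Sum>i\<in>UNIV. (t i / T) *\<^sub>R a i)"
    using T by (simp add: scaleR_sum_right)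
  ultimately show ?thesis unfolding T_def by blast
qed

lemma convex_cone_cone_Delta: "convex_cone (cone_Delta a)"
  unfolding cone_Delta_def by (rule convex_cone_convex_cone_hull)

lemma nonneg_combination_in_cone_Delta:
  fixes a :: "'m::finite \<Rightarrow> real ^ 'n"
  assumes "\<And>i. 0 \<le> t i"
  shows "(\<Sum>i\<in>UNIV. t i *\<^sub>R a i) \<in> cone_Delta a"
proof -
  have "a i \<in> cone_Delta a" for i
    unfolding cone_Delta_def Delta_def by (simp add: hull_inc)
  then have scaled: "t i *\<^sub>R a i \<in> cone_Delta a" for i
    using convex_cone_scaleR[OF convex_cone_cone_Delta] assms by blast
  have "(\<Sum>i\<in>I. t i *\<^sub>R a i) \<in> cone_Delta a" if "finite I" for I
    using that
    by (induction I)
      (auto simp: scaled convex_cone_add[OF convex_cone_cone_Delta] convex_cone_contains_0[OF convex_cone_cone_Delta])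
  then show ?thesis by simp
qed

text \<open>Convex combinations of the generators already lie in their convex cone. The finite
  generating set is what makes the cone closed.\<close>

lemma cone_Delta_eq: "cone_Delta a = convex_cone hull (range a \<union> {0})"
  unfolding cone_Delta_def Delta_def
  by (metis convex_hull_subset_convex_cone_hull hull_mono hull_subset hull_hull subset_antisym)

lemma closed_cone_Delta:
  fixes a :: "'m::finite \<Rightarrow> real ^ 'n"
  shows "closed (cone_Delta a)"
  unfolding cone_Delta_eq by (rule closed_convex_cone_hull) simp

lemma compact_Delta:
  fixes a :: "'m::finite \<Rightarrow> real ^ 'n"
  shows "compact (Delta a)"
  unfolding Delta_def by (intro compact_convex_hull finite_imp_compact) simp

text \<open>For a nonempty convex set, dilation alone produces the whole convex cone.\<close>

lemma cone_Delta_imp_dilate: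
  assumes "\<gamma> \<in> cone_Delta a"
  shows "\<exists>w\<ge>0. \<gamma> \<in> (\<lambda>x. w *\<^sub>R x) ` Delta a"
proof -
  have "cone_Delta a = conic hull (Delta a)"
    unfolding cone_Delta_eq Delta_def by (rule convex_cone_hull_separate_nonempty) simp
  then show ?thesis using assms by (auto simp: conic_hull_explicit)
qed

text \<open>The least dilation factor exists: the admissible \<open>w\<close> below a given bound form the projection
  of a compact set.\<close>
lemma w_Delta_least:
  fixes a :: "'m::finite \<Rightarrow> real ^ 'n::finite"
  assumes "\<gamma> \<in> cone_Delta a"
  shows w_Delta_nonneg: "0 \<le> w_Delta a \<gamma>"
    and w_Delta_le: "\<And>w. 0 \<le> w \<Longrightarrow> \<gamma> \<in> (\<lambda>x. w *\<^sub>R x) ` Delta a \<Longrightarrow> w_Delta a \<gamma> \<le> w"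
proof -
  let ?P = "\<lambda>w. 0 \<le> w \<and> \<gamma> \<in> (\<lambda>x. w *\<^sub>R x) ` Delta a"
  obtain M where M: "?P M" using cone_Delta_imp_dilate[OF assms] by blast
  define K where "K = ({0..M} \<times> Delta a) \<inter> {z. fst z *\<^sub>R snd z = \<gamma>}"
  have "compact K" unfolding K_def
    by (intro compact_Int_closed compact_Times compact_Icc compact_Delta closed_Collect_eq continuous_intros)
  then have "compact (fst ` K)" by (intro compact_continuous_image continuous_intros)
  moreover have in_K: "w \<in> fst ` K" if w: "?P w" "w \<le> M" for w
  proof -
    obtain x where "x \<in> Delta a" "w *\<^sub>R x = \<gamma>" using w by blast
    then have "(w, x) \<in> K" using w by (auto simp: K_def)
    then show ?thesis by force
  qed
  moreover have "fst ` K \<noteq> {}" using in_K[of M] M by auto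
  ultimately obtain m where m: "m \<in> fst ` K" "\<And>w. w \<in> fst ` K \<Longrightarrow> m \<le> w"
    using compact_attains_inf[of "fst ` K"] by blast
  have Pm: "?P m" using m(1) by (auto simp: K_def)
  \<comment> \<open>Factors above \<open>M\<close> lie outside the projection, but they exceed
    \<open>M\<close>, which is itself at least \<open>m\<close>.\<close>
  have min: "m \<le> w" if "?P w" for w
    using m(2)[of w] m(2)[of M] in_K[of w] in_K[of M] M that by (cases "w \<le> M") auto
  have "w_Delta a \<gamma> = m" unfolding w_Delta_def
    by (rule Least_equality) (use Pm min in auto)
  then show "0 \<le> w_Delta a \<gamma>"
    and "\<And>w. 0 \<le> w \<Longrightarrow> \<gamma> \<in> (\<lambda>x. w *\<^sub>R x) ` Delta a \<Longrightarrow> w_Delta a \<gamma> \<le> w"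
    using Pm min by auto
qed

text \<open>A nonzero \<open>x\<close> is interior to the segment from 0 to any longer multiple of
  \<open>x\<close>, so a face containing \<open>x\<close> contains both ends, and by convexity
  everything between them.\<close>

lemma face_of_convex_cone_scaleR:
  assumes S: "convex_cone S" and F: "F face_of S" and x: "x \<in> F" and c: "0 \<le> c"
  shows "c *\<^sub>R x \<in> F"
proof (cases "x = 0 \<or> c = 1")
  case True
  then show ?thesis using x by auto
next
  case False
  have xS: "x \<in> S" using F x face_of_imp_subset by blast
  \<comment> \<open>For \<open>c > 0\<close> the factor \<open>c + 1\<close> exceeds both 1 and
    \<open>c\<close>, so the segment from 0 to \<open>d *\<^sub>R x\<close> contains
    \<open>x\<close> in its interior and also passes through \<open>c *\<^sub>R x\<close>.\<close>
  define d where "d = c + 1"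
  have mem: "0 \<in> S" "d *\<^sub>R x \<in> S" "d > 1 \<or> c = 0"
    using S xS c by (auto simp: d_def convex_cone_contains_0 convex_cone_scaleR)
  have "x \<in> open_segment 0 (2 *\<^sub>R x)"
    using False by (auto simp: in_segment intro!: exI[of _ "1/2"])
  then have zero: "0 \<in> F"
    using face_ofD[OF F _ mem(1) convex_cone_scaleR[OF S _ xS] x, of 2] by simp
  show ?thesis
  proof (cases "c = 0")
    case True
    then show ?thesis using zero by simp
  next
    case c0: False
    have "x \<in> open_segment 0 (d *\<^sub>R x)"
      using False c c0 by (auto simp: in_segment d_def intro!: exI[of _ "1 / (c + 1)"])
    then have dx: "d *\<^sub>R x \<in> F" using face_ofD[OF F _ mem(1,2) x] by simp
    have "(1 - c / d) *\<^sub>R 0 + (c / d) *\<^sub>R (d *\<^sub>R x) \<in> F"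
      by (rule convexD) (use F zero dx c in \<open>auto simp: face_of_def d_def field_simps\<close>)
    then show ?thesis using c by (simp add: d_def)
  qed
qed

text \<open>The point \<open>x\<close> is the midpoint of twice
  \<open>\<epsilon> *\<^sub>R y\<close> and twice the remainder, both in the cone; the face property
  applies to this segment.\<close>

lemma face_of_convex_cone_dominated:
  assumes S: "convex_cone S" and F: "F face_of S" and x: "x \<in> F" and y: "y \<in> S"
    and \<epsilon>: "0 < \<epsilon>" and diff: "x - \<epsilon> *\<^sub>R y \<in> S"
  shows "y \<in> F"
proof -
  have "\<epsilon> *\<^sub>R y \<in> F"
  proof (cases "x = \<epsilon> *\<^sub>R y")
    case True
    then show ?thesis using x by simp
  next
    case False
    define u v where "u = 2 *\<^sub>R (\<epsilon> *\<^sub>R y)" and "v = 2 *\<^sub>R (x - \<epsilon> *\<^sub>R y)"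
    have uv: "u \<in> S" "v \<in> S" unfolding u_def v_def
      using convex_cone_scaleR[OF S] y diff \<epsilon> by auto
    have mid: "x = (1 - 1/2) *\<^sub>R u + (1/2) *\<^sub>R v" by (simp add: u_def v_def)
    \<comment> \<open>If \<open>u = v\<close>, the open segment is empty, but then the midpoint
      \<open>x\<close> is \<open>u\<close> itself.\<close>
    have "u \<in> F"
    proof (cases "u = v")
      case True
      then show ?thesis using mid x by (simp flip: scaleR_add_left)
    next
      case False
      then have "x \<in> open_segment u v"
        unfolding in_segment using mid by (auto intro!: exI[of _ "1/2 :: real"])
      then show ?thesis using face_ofD[OF F _ uv x] by blast
    qed
    from face_of_convex_cone_scaleR[OF S F this, of "1/2"] show ?thesis by (simp add: u_def)
  qed
  from face_of_convex_cone_scaleR[OF S F this, of "1 / \<epsilon>"] show ?thesis using \<epsilon> by simp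
qed

text \<open>Wherever \<open>u\<close> is positive so is \<open>t\<close>, so a small multiple of
  \<open>u\<close> lies below \<open>t\<close> coordinatewise. The difference of the two
  combinations then stays in the cone, and domination applies.\<close>

lemma face_of_cone_Delta_same_support:
  fixes a :: "'m::finite \<Rightarrow> real ^ 'n"
  assumes F: "F face_of cone_Delta a"
    and t: "\<And>i. 0 \<le> t i" and u: "\<And>i. 0 \<le> u i" and supp: "\<And>i. t i = 0 \<Longrightarrow> u i = 0"
    and tF: "(\<Sum>i\<in>UNIV. t i *\<^sub>R a i) \<in> F"
  shows "(\<Sum>i\<in>UNIV. u i *\<^sub>R a i) \<in> F"
proof -
  \<comment> \<open>The witness is a minimum of the ratios \<open>t i / u i\<close> over the indices
    with \<open>u i > 0\<close>, built up one index at a time.\<close>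
  have "\<exists>\<epsilon>>0. \<forall>i\<in>I. \<epsilon> * u i \<le> t i" if "finite I" for I
    using that
  proof (induction I)
    case empty
    show ?case by (auto intro: exI[of _ 1])
  next
    case (insert j I)
    then obtain \<epsilon> where \<epsilon>: "\<epsilon> > 0" "\<forall>i\<in>I. \<epsilon> * u i \<le> t i" by blast
    show ?case
    proof (cases "u j = 0")
      case True
      then show ?thesis using \<epsilon> t by auto
    next
      case False
      then have pos: "u j > 0" "t j > 0" using t[of j] u[of j] supp[of j] by (auto simp: less_le)
      define \<delta> where "\<delta> = min \<epsilon> (t j / u j)"
      have "\<delta> * u i \<le> \<epsilon> * u i" for i unfolding \<delta>_def by (intro mult_right_mono u) simp
      then have "\<forall>i\<in>I. \<delta> * u i \<le> t i" using \<epsilon>(2) by (meson order_trans)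
      moreover have "\<delta> * u j \<le> t j" using mult_right_mono[of \<delta> "t j / u j" "u j"] pos
        by (simp add: \<delta>_def)
      moreover have "\<delta> > 0" using \<epsilon> pos by (simp add: \<delta>_def)
      ultimately show ?thesis by auto
    qed
  qed
  from this[OF finite[of UNIV]] obtain \<epsilon> where \<epsilon>: "\<epsilon> > 0" "\<And>i. \<epsilon> * u i \<le> t i" by auto
  have "(\<Sum>i\<in>UNIV. t i *\<^sub>R a i) - \<epsilon> *\<^sub>R (\<Sum>i\<in>UNIV. u i *\<^sub>R a i) = (\<Sum>i\<in>UNIV. (t i - \<epsilon> * u i) *\<^sub>R a i)"
    by (simp add: scaleR_diff_left sum_subtractf scaleR_sum_right)
  also have "\<dots> \<in> cone_Delta a" using \<epsilon> by (intro nonneg_combination_in_cone_Delta) simp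
  finally show ?thesis
    by (rule face_of_convex_cone_dominated[OF convex_cone_cone_Delta F tF
          nonneg_combination_in_cone_Delta[OF u] \<epsilon>(1)])
qed

text \<open>An intersection of a nonempty family of faces is a face; the closed cone itself belongs
  to the family.\<close>

lemma min_face_face_of:
  fixes a :: "'m::finite \<Rightarrow> real ^ 'n::finite"
  assumes "\<gamma> \<in> cone_Delta a"
  shows "min_face a \<gamma> face_of cone_Delta a"
  unfolding min_face_def
proof (rule face_of_Inter)
  have "cone_Delta a face_of cone_Delta a"
    using convex_cone_cone_Delta by (intro face_of_refl) (auto simp: convex_cone_def)
  then show "{F. F face_of cone_Delta a \<and> closed F \<and> \<gamma> \<in> F} \<noteq> {}"
    using assms closed_cone_Delta by blast
qed auto

text \<open>Both combinations lie in exactly the same faces of the cone. A face of the minimal face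
  is a face of the cone, so if it contains one point it contains the other and cannot be
  proper.\<close>

lemma open_face_same_support:
  fixes a :: "'m::finite \<Rightarrow> real ^ 'n::finite"
  assumes t: "\<And>i. 0 \<le> t i" and u: "\<And>i. 0 \<le> u i" and supp: "\<And>i. t i = 0 \<longleftrightarrow> u i = 0"
  shows "(\<Sum>i\<in>UNIV. u i *\<^sub>R a i) \<in> open_face a (\<Sum>i\<in>UNIV. t i *\<^sub>R a i)"
proof -
  define x y where "x = (\<Sum>i\<in>UNIV. t i *\<^sub>R a i)" and "y = (\<Sum>i\<in>UNIV. u i *\<^sub>R a i)"
  have iff: "x \<in> F \<longleftrightarrow> y \<in> F" if "F face_of cone_Delta a" for F
    unfolding x_def y_def
    using face_of_cone_Delta_same_support[OF that t u] face_of_cone_Delta_same_support[OF that u t] supp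
    by (intro iffI) simp_all
  have "y \<in> min_face a x" using iff by (auto simp: min_face_def)
  moreover have "F = min_face a x" if "F face_of min_face a x" "closed F" "y \<in> F" for F
  proof
    show "F \<subseteq> min_face a x" using that(1) by (rule face_of_imp_subset)
    have "x \<in> cone_Delta a" unfolding x_def using t by (rule nonneg_combination_in_cone_Delta)
    then have "F face_of cone_Delta a" using that(1) min_face_face_of face_of_trans by blast
    then show "min_face a x \<subseteq> F" using that iff by (auto simp: min_face_def)
  qed
  ultimately show ?thesis unfolding open_face_def x_def[symmetric] y_def[symmetric] by blast
qed

lemma w_Delta_set_le:
  fixes a :: "'m::finite \<Rightarrow> real ^ 'n::finite"
  assumes X: "X \<subseteq> cone_Delta a" and t: "\<And>i. 0 \<le> t i" and mem: "(\<Sum>i\<in>UNIV. t i *\<^sub>R a i) \<in> X"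
  shows "w_Delta_set a X \<le> (\<Sum>i\<in>UNIV. t i)"
proof -
  \<comment> \<open>A real-valued \<open>INF\<close> is a lower bound of its family only if the
    family is bounded below; nonnegativity of \<open>w_Delta\<close> supplies this.\<close>
  have "bdd_below (w_Delta a ` X)" using X w_Delta_nonneg by (auto intro!: bdd_belowI[of _ 0])
  then have "w_Delta_set a X \<le> w_Delta a (\<Sum>i\<in>UNIV. t i *\<^sub>R a i)"
    unfolding w_Delta_set_def using mem by (rule cINF_lower)
  also have "\<dots> \<le> (\<Sum>i\<in>UNIV. t i)"
    using X mem t by (intro w_Delta_le convex_combination_in_Delta sum_nonneg) auto
  finally show ?thesis .
qed

subsection \<open>Periodicity of the lattice cosets\<close>

lemma lattice_coset_eq_iff: "lattice_coset u = lattice_coset v \<longleftrightarrow> u - v \<in> int_lattice"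
proof
  assume "lattice_coset u = lattice_coset v"
  moreover have "u \<in> lattice_coset u"
    unfolding lattice_coset_def by (rule image_eqI[of _ _ 0]) (auto simp: int_lattice_def)
  ultimately show "u - v \<in> int_lattice" by (auto simp: lattice_coset_def)
next
  have sub: "lattice_coset u \<subseteq> lattice_coset v" if "u - v \<in> int_lattice" for u v :: "real ^ 'n"
  proof
    fix x assume "x \<in> lattice_coset u"
    then obtain z where "z \<in> int_lattice" "x = u + z" by (auto simp: lattice_coset_def)
    then show "x \<in> lattice_coset v" using that
      by (auto simp: lattice_coset_def int_lattice_def intro!: image_eqI[of _ _ "u - v + z"])
  qed
  assume uv: "u - v \<in> int_lattice"
  then have "v - u \<in> int_lattice" by (auto simp: int_lattice_def) (metis Ints_minus minus_diff_eq)
  then show "lattice_coset u = lattice_coset v" using uv sub by blast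
qed

lemma lattice_coset_eq_of_mem: "x \<in> lattice_coset v \<Longrightarrow> lattice_coset v = lattice_coset x"
  by (subst lattice_coset_eq_iff) (auto simp: lattice_coset_def int_lattice_def)

text \<open>Shifting by \<open>k\<close> is division by \<open>p ^ k\<close> modulo \<open>\<int>\<close> on numbers with denominator prime to \<open>p\<close>,
  so it preserves congruences.\<close>
lemma r_shift_combination_cong:
  fixes a :: "'m::finite \<Rightarrow> real ^ 'n::finite"
  assumes p: "prime p" and A: "range a \<subseteq> int_lattice" and r: "r \<in> R_set p"
    and cong: "(\<Sum>i\<in>UNIV. r_shift p l r $ i *\<^sub>R a i) - (\<Sum>i\<in>UNIV. r $ i *\<^sub>R a i) \<in> int_lattice"
  shows "(\<Sum>i\<in>UNIV. r_shift p (k + l) r $ i *\<^sub>R a i) - (\<Sum>i\<in>UNIV. r_shift p k r $ i *\<^sub>R a i) \<in> int_lattice"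
    (is "?x \<in> _")
proof -
  define d where "d i = r_shift p (k + l) r $ i - r_shift p k r $ i" for i
  have aI: "a i $ j \<in> \<int>" for i j using A by (auto simp: int_lattice_def)
  have x: "?x $ j = (\<Sum>i\<in>UNIV. d i * a i $ j)" for j
    by (simp add: d_def left_diff_distrib sum_subtractf)
  obtain D :: int where D: "\<not> int p dvd D" "\<And>k i. of_int D * r_shift p k r $ i \<in> \<int>"
    using shift_props(1)[OF p r] by blast
  \<comment> \<open>Both \<open>p ^ l\<close> and the common denominator \<open>D\<close> turn this
    difference into an integer; they are coprime, so it is an integer already.\<close>
  have shift: "real p ^ k * r_shift p (k + l) r $ i - r_shift p l r $ i \<in> \<int>" for i
  proof -
    have "coprime (int p ^ l) D"
      using D p by (auto simp: coprime_power_left_iff intro!: prime_imp_coprime)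
    moreover have "of_int (int p ^ l) * (real p ^ k * r_shift p (k + l) r $ i - r_shift p l r $ i)
        = (real p ^ (k + l) * r_shift p (k + l) r $ i - r $ i) - (real p ^ l * r_shift p l r $ i - r $ i)"
      by (simp add: algebra_simps power_add)
    then have "of_int (int p ^ l) * (real p ^ k * r_shift p (k + l) r $ i - r_shift p l r $ i) \<in> \<int>"
      using shift_props(2)[OF p r] by (metis Ints_diff)
    moreover have "of_int D * (real p ^ k * r_shift p (k + l) r $ i - r_shift p l r $ i)
        = real p ^ k * (of_int D * r_shift p (k + l) r $ i) - of_int D * r_shift p l r $ i"
      by (simp add: algebra_simps)
    then have "of_int D * (real p ^ k * r_shift p (k + l) r $ i - r_shift p l r $ i) \<in> \<int>"
      using D(2) by (simp add: Ints_power)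
    ultimately show ?thesis by (rule coprime_Ints)
  qed
  \<comment> \<open>The same coprimality argument with \<open>p ^ k\<close>: modulo integers,
    \<open>p ^ k\<close> times this coordinate is the corresponding coordinate of the difference
    assumed in \<open>cong\<close>.\<close>
  have "?x $ j \<in> \<int>" for j
  proof (rule coprime_Ints)
    show "coprime (int p ^ k) D"
      using D p by (auto simp: coprime_power_left_iff intro!: prime_imp_coprime)
    have "of_int D * ?x $ j =
        (\<Sum>i\<in>UNIV. (of_int D * r_shift p (k + l) r $ i - of_int D * r_shift p k r $ i) * a i $ j)"
      unfolding x d_def by (simp add: sum_distrib_left algebra_simps)
    also have "\<dots> \<in> \<int>" by (intro Ints_sum Ints_mult Ints_diff D(2) aI)
    finally show "of_int D * ?x $ j \<in> \<int>" .
    define c where "c i = (real p ^ k * r_shift p (k + l) r $ i - r_shift p l r $ i)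
        - (real p ^ k * r_shift p k r $ i - r $ i)" for i
    have "c i \<in> \<int>" for i unfolding c_def by (rule Ints_diff[OF shift shift_props(2)[OF p r]])
    then have "(\<Sum>i\<in>UNIV. c i * a i $ j) \<in> \<int>" by (intro Ints_sum Ints_mult aI)
    moreover have "(\<Sum>i\<in>UNIV. r_shift p l r $ i * a i $ j) - (\<Sum>i\<in>UNIV. r $ i * a i $ j) \<in> \<int>"
      using cong by (simp add: int_lattice_def)
    moreover have "of_int (int p ^ k) * ?x $ j = (\<Sum>i\<in>UNIV. c i * a i $ j)
        + ((\<Sum>i\<in>UNIV. r_shift p l r $ i * a i $ j) - (\<Sum>i\<in>UNIV. r $ i * a i $ j))"
      by (simp add: x d_def c_def algebra_simps sum_subtractf sum.distrib sum_distrib_left)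
    ultimately show "of_int (int p ^ k) * ?x $ j \<in> \<int>" by simp
  qed
  then show ?thesis by (simp add: int_lattice_def)
qed

lemma sum_lessThan_periodic:
  fixes f :: "nat \<Rightarrow> 'a::comm_semiring_1"
  assumes "\<And>k. f (k + n) = f k"
  shows "(\<Sum>k<m * n. f k) = of_nat m * (\<Sum>k<n. f k)"
proof (induction m)
  case (Suc m)
  have per: "f (k + m * n) = f k" for k m
    by (induction m) (simp, metis assms add.assoc add.commute mult_Suc)
  have "(\<Sum>k<m * n + j. f k) = (\<Sum>k<m * n. f k) + (\<Sum>k<j. f (k + m * n))" for j
    by (induction j) (simp_all add: add_ac)
  from this[of n] show ?case using Suc by (simp add: per algebra_simps)
qed simp

section \<open>Comparison of the two averages over a common multiple of their periods\<close>

theorem theorem3p5: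
  fixes p :: nat
    and a :: "'m::finite \<Rightarrow> real ^ 'n::finite"
    and \<beta> :: "real ^ 'n"
    and b :: "nat \<Rightarrow> real ^ 'n"
    and e :: nat
  assumes "prime p"
    and "range a \<subseteq> int_lattice"
    and "R_beta p a \<beta> \<noteq> {}"
    and "is_beta_shift p a \<beta> b"
    and "e = beta_period \<beta> b"
  shows "weight_R_beta p a \<beta> \<ge>
           (real p - 1) / real e *
             (\<Sum>k<e. w_Delta_set a (open_face a (- \<beta>) \<inter> lattice_coset (- b k)))"
  unfolding weight_R_beta_def
proof (rule cINF_greatest)
  fix r assume "r \<in> R_beta p a \<beta>"
  then have r: "r \<in> R_set p" and beta: "\<beta> = (\<Sum>i\<in>UNIV. r $ i *\<^sub>R a i)"
    and shift_mem: "\<And>k. - (\<Sum>i\<in>UNIV. r_shift p k r $ i *\<^sub>R a i) \<in> lattice_coset (- b k)"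
    using assms(4) by (auto simp: R_beta_def is_beta_shift_def)
  define n where "n = period p r"
  \<comment> \<open>The sign is placed on the coefficients so that they are nonnegative and their
    sum \<open>W k\<close> bounds \<open>w_Delta a (\<gamma> k)\<close>.\<close>
  define \<gamma> where "\<gamma> k = (\<Sum>i\<in>UNIV. - r_shift p k r $ i *\<^sub>R a i)" for k
  define X where "X k = open_face a (- \<beta>) \<inter> lattice_coset (- b k)" for k
  define W where "W k = (\<Sum>i\<in>UNIV. - r_shift p k r $ i)" for k
  have n: "0 < n" using period_pos[OF assms(1) r] by (simp add: n_def)
  have \<gamma>0: "\<gamma> 0 = - \<beta>" by (simp add: \<gamma>_def r_shift_0[OF assms(1) r] beta sum_negf)
  have per: "r_shift p (k + n) r = r_shift p k r" for k
    unfolding n_def by (rule r_shift_period[OF assms(1) r])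
  \<comment> \<open>The family \<open>b\<close> enters only through its cosets, and
    \<open>\<gamma> k\<close> represents the \<open>k\<close>-th one.\<close>
  have coset: "lattice_coset (- b k) = lattice_coset (\<gamma> k)" for k
    using lattice_coset_eq_of_mem[OF shift_mem[of k]] by (simp add: \<gamma>_def sum_negf)
  have nonneg: "0 \<le> - r_shift p k r $ i" for k i
    using r_shift_nonpos[OF assms(1) r] by simp
  have \<gamma>_cone: "\<gamma> k \<in> cone_Delta a" for k
    unfolding \<gamma>_def using nonneg by (rule nonneg_combination_in_cone_Delta)

  \<comment> \<open>The cycle length \<open>n\<close> witnesses that the \<open>LEAST\<close> in
    \<open>beta_period\<close> is attained, so \<open>e\<close> is positive and has the defining
    property.\<close>
  have "\<gamma> n = \<gamma> 0" using per[of 0] by (simp add: \<gamma>_def)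
  then have "0 < n \<and> lattice_coset (- b n) = lattice_coset (- \<beta>)" using n \<gamma>0 coset by metis
  then have e: "0 < e" "lattice_coset (- b e) = lattice_coset (- \<beta>)"
    unfolding assms(5) beta_period_def by (metis (mono_tags, lifting) LeastI)+
  \<comment> \<open>By definition \<open>e\<close> returns only the coset of index 0 to itself;
    \<open>r_shift_combination_cong\<close> carries this congruence to every
    \<open>k\<close>.\<close>
  have "\<gamma> (k + e) - \<gamma> k \<in> int_lattice" for k
  proof -
    have "\<gamma> e - \<gamma> 0 \<in> int_lattice" using e(2) coset \<gamma>0 lattice_coset_eq_iff by metis
    then have "lattice_coset (- \<gamma> 0) = lattice_coset (- \<gamma> e)"
      by (simp add: lattice_coset_eq_iff)
    then have "(\<Sum>i\<in>UNIV. r_shift p e r $ i *\<^sub>R a i) - (\<Sum>i\<in>UNIV. r $ i *\<^sub>R a i) \<in> int_lattice"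
      using lattice_coset_eq_iff[of "- \<gamma> e" "- \<gamma> 0"]
      by (simp add: \<gamma>_def sum_negf r_shift_0[OF assms(1) r])
    from r_shift_combination_cong[OF assms(1,2) r this, of k]
    have "lattice_coset (- \<gamma> (k + e)) = lattice_coset (- \<gamma> k)"
      by (simp add: lattice_coset_eq_iff \<gamma>_def sum_negf)
    then show ?thesis using lattice_coset_eq_iff[of "- \<gamma> k" "- \<gamma> (k + e)"] by simp
  qed
  then have X_per: "X (k + e) = X k" for k
    using lattice_coset_eq_iff unfolding X_def coset by metis

  have le: "w_Delta_set a (X k) \<le> W k" for k
    unfolding W_def
  proof (rule w_Delta_set_le)
    have "- \<beta> \<in> cone_Delta a" using \<gamma>_cone[of 0] \<gamma>0 by simp
    then have "min_face a (- \<beta>) \<subseteq> cone_Delta a" by (intro face_of_imp_subset min_face_face_of)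
    then show "X k \<subseteq> cone_Delta a" by (auto simp: X_def open_face_def)
    \<comment> \<open>All shifts of \<open>r\<close> vanish at the same coordinates, so the open
      face of \<open>- \<beta>\<close> contains each \<open>\<gamma> k\<close>.\<close>
    have "\<gamma> k \<in> open_face a (\<gamma> 0)"
      unfolding \<gamma>_def using nonneg
      by (intro open_face_same_support) (auto simp: r_shift_eq_0_iff[OF assms(1) r])
    then show "(\<Sum>i\<in>UNIV. - r_shift p k r $ i *\<^sub>R a i) \<in> X k"
      using shift_mem[of k] \<gamma>0 by (simp add: X_def \<gamma>_def sum_negf)
  qed (rule nonneg)

  \<comment> \<open>The left terms have period \<open>e\<close> and the right terms period
    \<open>n\<close>, so over \<open>n * e\<close> indices they can be compared term by term and
    both sums regrouped.\<close>
  have "real n * (\<Sum>k<e. w_Delta_set a (X k)) = (\<Sum>k<n * e. w_Delta_set a (X k))"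
    by (rule sum_lessThan_periodic[symmetric]) (simp add: X_per)
  also have "\<dots> \<le> (\<Sum>k<e * n. W k)" by (simp add: mult.commute sum_mono le)
  also have "\<dots> = real e * (\<Sum>k<n. W k)"
    by (rule sum_lessThan_periodic) (simp add: W_def per)
  finally have "(\<Sum>k<e. w_Delta_set a (X k)) / real e \<le> (\<Sum>k<n. W k) / real n"
    using n e(1) by (simp add: field_simps)
  then have "(real p - 1) * ((\<Sum>k<e. w_Delta_set a (X k)) / real e) \<le> (real p - 1) * ((\<Sum>k<n. W k) / real n)"
    using prime_ge_1_nat[OF assms(1)] by (intro mult_left_mono) auto
  then show "(real p - 1) / real e * (\<Sum>k<e. w_Delta_set a (open_face a (- \<beta>) \<inter> lattice_coset (- b k))) \<le> weight p r"
    unfolding weight_eq_sum_r_shift[OF assms(1) r] by (simp add: X_def W_def n_def)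
qed (use assms(3) in blast)

end
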